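(* Let $\mathbb{K}\in\{\mathbb{R},\mathbb{C}\}$, $d\ge 1$, and let $\mathcal{M}\subseteq\mathbb{K}^{d\times d}$ be a nonempty compact set of matrices with joint spectral radius $\rho(\mathcal{M})>0$. Then there exists an invertible matrix $T\in \mathbf{GL}_d(\mathbb{K})$ such that $$\rho(\mathcal{M}) \geq \max\{\, |a_{ij}| \;:\; 1\leq i,j\leq d,\ A=(a_{ij})_{i,j=1}^d \in T^{-1}\mathcal{M}T \,\}.$$
   Context: For a nonempty bounded set $\mathcal{M}\subseteq\mathbb{K}^{d\times d}$ and an integer $t\ge 1$ let $\mathcal{S}_t := \{A(t-1)\cdots A(0) : A(s)\in\mathcal{M},\ s=0,\dots,t-1\}$ be the set of products of length $t$. The joint spectral radius is $\rho(\mathcal{M}) := \lim_{t\to\infty}\sup\{\|S\|_2 : S\in\mathcal{S}_t\}^{1/t}$, where $\|\cdot\|_2$ is the spectral norm (the operator norm induced by the Euclidean norm). For $T\in\mathbf{GL}_d(\mathbb{K})$, $T^{-1}\mathcal{M}T := \{T^{-1}AT : A\in\mathcal{M}\}$. *)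

theory Defs
  imports "HOL-Analysis.Analysis"
begin

text \<open>The norm on \<open>'a ^ 'n\<close> is the Euclidean one, so this is the spectral norm. For
  \<open>'a = complex\<close> the supremum in \<^const>\<open>onorm\<close> still ranges over all complex vectors.\<close>

definition spectral_norm :: "'a::real_normed_field ^ 'n ^ 'n \<Rightarrow> real" where
  "spectral_norm A = onorm (\<lambda>x. A *v x)"

text \<open>\<open>mat_product A t\<close> is \<open>A (t - 1) ** \<dots> ** A 0\<close>.\<close>

primrec mat_product :: "(nat \<Rightarrow> 'a::semiring_1 ^ 'n ^ 'n) \<Rightarrow> nat \<Rightarrow> 'a ^ 'n ^ 'n" where
  "mat_product A 0 = mat 1"
| "mat_product A (Suc t) = A t ** mat_product A t"

definition products_of_length :: "('a::semiring_1 ^ 'n ^ 'n) set \<Rightarrow> nat \<Rightarrow> ('a ^ 'n ^ 'n) set" where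
  "products_of_length M t = {mat_product A t | A. \<forall>s<t. A s \<in> M}"

text \<open>Meaningful for nonempty bounded \<open>M\<close>; the value of the sequence at \<open>t = 0\<close> is irrelevant.\<close>

definition joint_spectral_radius :: "('a::real_normed_field ^ 'n ^ 'n) set \<Rightarrow> real" where
  "joint_spectral_radius M =
     lim (\<lambda>t. root t (SUP S\<in>products_of_length M t. spectral_norm S))"

definition similar_set :: "'a::semiring_1 ^ 'n ^ 'n \<Rightarrow> ('a ^ 'n ^ 'n) set \<Rightarrow> ('a ^ 'n ^ 'n) set" where
  "similar_set T M = {matrix_inv T ** A ** T | A. A \<in> M}"

definition entry_moduli :: "('a::real_normed_field ^ 'n ^ 'n) set \<Rightarrow> real set" where
  "entry_moduli M = {norm (A $ i $ j) | A i j. A \<in> M}"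

text \<open>\<^const>\<open>Max\<close> is only meaningful on finite sets.\<close>

definition is_maximum :: "real \<Rightarrow> real set \<Rightarrow> bool" where
  "is_maximum m E \<longleftrightarrow> m \<in> E \<and> (\<forall>x\<in>E. x \<le> m)"

end

theory Submission
  imports Defs
begin

text \<open>
  Write \<open>K\<close> for the scalar field, \<open>r = \<rho>(M)\<close>, and suppose first that some norm \<open>p\<close> on
  \<open>K\<^sup>d\<close> satisfies \<open>p (A x) \<le> r * p x\<close> for all \<open>A\<close> in \<open>M\<close>. An Auerbach basis \<open>e\<close> of \<open>p\<close> has
  \<open>p (e j) \<le> 1\<close> and coordinate functionals of \<open>p\<close>-norm at most \<open>1\<close>, so the \<open>i\<close>-th coordinate of
  \<open>A (e j)\<close> is at most \<open>p (A (e j)) \<le> r\<close>: in this basis all entries are bounded by \<open>r\<close>.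

  In general there is no such norm, but there is always a nonzero \<^emph>\<open>seminorm\<close> of this kind on each
  nonzero invariant subspace \<open>V\<close> (\<open>invariant_seminorm\<close>). For \<open>s > r\<close> the supremum of
  \<open>norm (S x) / s ^ t\<close> over all products \<open>S\<close> of length \<open>t\<close>, for all \<open>t\<close>, is a norm that each \<open>A\<close>
  in \<open>M\<close> increases by at most the factor \<open>s\<close>. Normalised so that its values on a fixed basis of \<open>V\<close>
  add up to \<open>1\<close>, it stays bounded as \<open>s\<close> decreases to \<open>r\<close>, and the pointwise limes superior is the
  seminorm wanted; the normalisation keeps it from vanishing. That the suprema are finite is the
  content of \<open>growth_rate_joint_spectral_radius\<close>, which rests on Fekete's lemma.

  The kernel \<open>W\<close> of the seminorm is an invariant subspace of smaller dimension, which makes an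
  induction on \<open>V\<close> possible (\<open>basis_with_bounded_coefficients\<close>). A good basis of \<open>W\<close> is extended by a
  multiple \<open>\<delta>\<close> of an Auerbach basis of a complement of \<open>W\<close>. Coefficients that stay within \<open>W\<close> are
  bounded by induction, and those within the complement by the Auerbach argument, whatever
  \<open>\<delta>\<close> is; since \<open>W\<close> is invariant, the only other nonzero coefficients describe the \<open>W\<close>-part of the
  image of a vector of length about \<open>\<delta>\<close>, and they are at most \<open>r\<close> if \<open>\<delta>\<close> is small. This last step is
  the only one that needs \<open>r > 0\<close>.

  Everything is done for a normed field that is also a Euclidean space, which covers the real and the
  complex numbers at once.
\<close>

section \<open>Vectors over a normed field\<close>

lemma norm_vector_smult:
  fixes x :: "'a::real_normed_field ^ 'n"
  shows "norm (c *s x) = norm c * norm x"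
  by (simp add: norm_vec_def norm_mult L2_set_right_distrib)

lemma scaleR_eq_vector_smult:
  fixes x :: "'a::real_normed_field ^ 'n"
  shows "a *\<^sub>R x = of_real a *s x"
  by (simp add: vec_eq_iff scaleR_conv_of_real[where 'a='a])

lemma row_eq_nth: "row i A = A $ i"
  by (simp add: row_def vec_lambda_eta)

lemma closed_vec_subspace:
  fixes U :: "('a::{real_normed_field,euclidean_space} ^ 'n) set"
  assumes "vec.subspace U"
  shows "closed U"
proof (rule closed_subspace)
  show "subspace U"
    using assms unfolding subspace_def vec.subspace_def by (simp add: scaleR_eq_vector_smult)
qed

lemma compact_vec_box:
  fixes C :: "'n::finite \<Rightarrow> 'b::euclidean_space set"
  assumes "\<And>j. compact (C j)"
  shows "compact {T. \<forall>j. T $ j \<in> C j}"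
proof -
  have "\<forall>j. \<exists>b. \<forall>x\<in>C j. norm x \<le> b"
    using assms compact_imp_bounded bounded_iff by blast
  then obtain b where b: "\<And>j x. x \<in> C j \<Longrightarrow> norm x \<le> b j"
    by metis
  have "norm T \<le> (\<Sum>j\<in>UNIV. b j)" if "\<forall>j. T $ j \<in> C j" for T
  proof -
    have "norm T \<le> (\<Sum>j\<in>UNIV. norm (T $ j))"
      unfolding norm_vec_def by (rule L2_set_le_sum) simp
    also have "\<dots> \<le> (\<Sum>j\<in>UNIV. b j)"
      using that b by (intro sum_mono) auto
    finally show ?thesis .
  qed
  then have "bounded {T. \<forall>j. T $ j \<in> C j}"
    unfolding bounded_iff by blast
  moreover have "closed {T. \<forall>j. T $ j \<in> C j}"
  proof (intro closed_Collect_all)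
    fix j
    have "closed ((\<lambda>T. T $ j) -` C j)"
      by (intro closed_vimage compact_imp_closed assms continuous_intros)
    then show "closed {T. T $ j \<in> C j}"
      by (simp add: vimage_def)
  qed
  ultimately show ?thesis
    by (simp add: compact_eq_bounded_closed)
qed

section \<open>Seminorms on subspaces\<close>

definition seminorm_on :: "('a::real_normed_field ^ 'n) set \<Rightarrow> ('a ^ 'n \<Rightarrow> real) \<Rightarrow> bool" where
  "seminorm_on V p \<longleftrightarrow>
     (\<forall>x\<in>V. \<forall>y\<in>V. p (x + y) \<le> p x + p y) \<and> (\<forall>c. \<forall>x\<in>V. p (c *s x) = norm c * p x)"

text \<open>One inequality is enough for homogeneity: the reverse one results from applying it to the
  inverse scalar.\<close>

lemma seminorm_onI:
  assumes V: "vec.subspace V"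
    and add: "\<And>x y. x \<in> V \<Longrightarrow> y \<in> V \<Longrightarrow> p (x + y) \<le> p x + p y"
    and smult: "\<And>c x. x \<in> V \<Longrightarrow> p (c *s x) \<le> norm c * p x"
  shows "seminorm_on V p"
proof -
  have "p (c *s x) = norm c * p x" if x: "x \<in> V" for c x
  proof (cases "c = 0")
    case True
    then show ?thesis
      using add[of 0 0] smult[OF x, of 0] vec.subspace_0[OF V] by simp
  next
    case False
    have "p (inverse c *s (c *s x)) \<le> norm (inverse c) * p (c *s x)"
      using x V by (intro smult vec.subspace_scale)
    then have "p x \<le> p (c *s x) / norm c"
      using False by (simp add: norm_inverse divide_inverse mult.commute)
    then show ?thesis
      using smult[OF x, of c] False by (simp add: field_simps)
  qed
  with add show ?thesis by (simp add: seminorm_on_def)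
qed

lemma seminorm_on_add:
  "seminorm_on V p \<Longrightarrow> x \<in> V \<Longrightarrow> y \<in> V \<Longrightarrow> p (x + y) \<le> p x + p y"
  by (simp add: seminorm_on_def)

lemma seminorm_on_smult: "seminorm_on V p \<Longrightarrow> x \<in> V \<Longrightarrow> p (c *s x) = norm c * p x"
  by (simp add: seminorm_on_def)

lemma seminorm_on_subset: "seminorm_on V p \<Longrightarrow> U \<subseteq> V \<Longrightarrow> seminorm_on U p"
  unfolding seminorm_on_def by blast

lemma seminorm_on_zero:
  assumes "seminorm_on V p" "vec.subspace V"
  shows "p 0 = 0"
  using seminorm_on_smult[OF assms(1) vec.subspace_0[OF assms(2)], of 0] by simp

lemma seminorm_on_nonneg:
  assumes "seminorm_on V p" "vec.subspace V" "x \<in> V"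
  shows "0 \<le> p x"
proof -
  have "(-1) *s x \<in> V"
    using assms vec.subspace_scale by blast
  then have "p (x + (-1) *s x) \<le> p x + p ((-1) *s x)"
    using assms seminorm_on_add by blast
  moreover have "x + (-1) *s x = 0"
    by (simp add: vec_eq_iff)
  ultimately show ?thesis
    using seminorm_on_zero[OF assms(1,2)] seminorm_on_smult[OF assms(1,3), of "-1"] by simp
qed

lemma seminorm_on_sum:
  assumes p: "seminorm_on V p" and V: "vec.subspace V" and "\<And>i. i \<in> I \<Longrightarrow> f i \<in> V"
  shows "p (\<Sum>i\<in>I. f i) \<le> (\<Sum>i\<in>I. p (f i))"
  using assms(3)
proof (induction I rule: infinite_finite_induct)
  case (insert i I)
  have "p (f i + sum f I) \<le> p (f i) + p (sum f I)"
    using insert.prems by (intro seminorm_on_add[OF p] vec.subspace_sum[OF V]) auto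
  then show ?case using insert by simp
qed (use seminorm_on_zero[OF p V] in auto)

lemma seminorm_le_norm:
  fixes q :: "'a::real_normed_field ^ 'n \<Rightarrow> real"
  assumes q: "seminorm_on UNIV q"
  obtains C where "0 \<le> C" "\<And>x. q x \<le> C * norm x"
proof -
  define C where "C = (\<Sum>i\<in>UNIV. q (axis i 1))"
  have nonneg: "0 \<le> q x" for x
    using seminorm_on_nonneg[OF q] by simp
  have C0: "0 \<le> C"
    unfolding C_def by (intro sum_nonneg nonneg)
  have "q x \<le> C * norm x" for x
  proof -
    have "q x = q (\<Sum>i\<in>UNIV. (x $ i) *s axis i 1)"
      by (simp add: basis_expansion)
    also have "\<dots> \<le> (\<Sum>i\<in>UNIV. q ((x $ i) *s axis i 1))"
      by (rule seminorm_on_sum[OF q]) auto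
    also have "\<dots> = (\<Sum>i\<in>UNIV. norm (x $ i) * q (axis i 1))"
      by (simp add: seminorm_on_smult[OF q])
    also have "\<dots> \<le> (\<Sum>i\<in>UNIV. norm x * q (axis i 1))"
      by (intro sum_mono mult_right_mono nonneg Finite_Cartesian_Product.norm_nth_le)
    finally show ?thesis
      by (simp add: C_def sum_distrib_left mult.commute)
  qed
  with C0 that show ?thesis by blast
qed

text \<open>A linear projection onto \<open>U\<close> extends \<open>p\<close> to a seminorm on the whole space.\<close>

lemma seminorm_on_le_norm:
  fixes U :: "('a::real_normed_field ^ 'n) set"
  assumes U: "vec.subspace U" and p: "seminorm_on U p"
  obtains C where "0 \<le> C" "\<And>x. x \<in> U \<Longrightarrow> p x \<le> C * norm x"
proof -
  have "\<exists>g. g ` UNIV \<subseteq> U \<and> Vector_Spaces.linear (*s) (*s) g \<and> (\<forall>v\<in>U. g (id v) = v)"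
    by (rule vec.linear_exists_left_inverse_on[OF vec.linear_id U]) simp
  then obtain g where g: "\<And>x. g x \<in> U" "Vector_Spaces.linear (*s) (*s) g" "\<And>x. x \<in> U \<Longrightarrow> g x = x"
    by auto
  interpret g: Vector_Spaces.linear "(*s)" "(*s)" g by fact
  have "seminorm_on UNIV (\<lambda>x. p (g x))"
    unfolding seminorm_on_def
    by (simp add: g.add g.scale seminorm_on_add[OF p] seminorm_on_smult[OF p] g(1))
  then obtain C where "0 \<le> C" "\<And>x. p (g x) \<le> C * norm x"
    using seminorm_le_norm by blast
  then show ?thesis
    using that g(3) by metis
qed

lemma seminorm_on_continuous_on:
  fixes U :: "('a::real_normed_field ^ 'n) set"
  assumes U: "vec.subspace U" and p: "seminorm_on U p"
  shows "continuous_on U p"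
proof -
  obtain C where C: "0 \<le> C" "\<And>x. x \<in> U \<Longrightarrow> p x \<le> C * norm x"
    using seminorm_on_le_norm[OF U p] by blast
  have *: "p x - p y \<le> C * dist x y" if "x \<in> U" "y \<in> U" for x y
  proof -
    have "x - y \<in> U" using that U vec.subspace_diff by blast
    then show ?thesis
      using seminorm_on_add[OF p, of "x - y" y] C(2)[of "x - y"] that by (simp add: dist_norm)
  qed
  have "dist (p x) (p y) \<le> C * dist x y" if "x \<in> U" "y \<in> U" for x y
    using *[OF that] *[OF that(2,1)] by (simp add: dist_real_def dist_commute abs_le_iff)
  then have "C-lipschitz_on U p"
    using C(1) by (auto intro: lipschitz_onI)
  then show ?thesis
    by (rule lipschitz_on_continuous_on)
qed

text \<open>Compactness of the Euclidean unit sphere of \<open>U\<close>.\<close>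

lemma norm_on_ge_norm:
  fixes U :: "('a::{real_normed_field,euclidean_space} ^ 'n) set"
  assumes U: "vec.subspace U" and p: "seminorm_on U p"
    and pos: "\<And>x. x \<in> U \<Longrightarrow> p x = 0 \<Longrightarrow> x = 0"
  obtains c where "c > 0" "\<And>x. x \<in> U \<Longrightarrow> c * norm x \<le> p x"
proof (cases "U \<inter> sphere 0 1 = {}")
  case True
  have triv: "x = 0" if "x \<in> U" for x
  proof (rule ccontr)
    assume "x \<noteq> 0"
    then have "of_real (1 / norm x) *s x \<in> U \<inter> sphere 0 1"
      using vec.subspace_scale[OF U that] by (auto simp: norm_vector_smult norm_divide)
    then show False using True by blast
  qed
  have "1 * norm x \<le> p x" if "x \<in> U" for x
    using triv[OF that] seminorm_on_zero[OF p U] by simp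
  then show ?thesis
    using that[of 1] by simp
next
  case False
  have "compact (U \<inter> sphere 0 1)"
    by (intro closed_Int_compact closed_vec_subspace U compact_sphere)
  then obtain y where y: "y \<in> U" "norm y = 1" and min: "\<And>x. x \<in> U \<inter> sphere 0 1 \<Longrightarrow> p y \<le> p x"
    using continuous_attains_inf[of "U \<inter> sphere 0 1" p] False continuous_on_subset[OF seminorm_on_continuous_on[OF U p]]
    by (metis IntE inf_le1 mem_sphere_0)
  have py: "p y > 0"
    using pos[of y] y seminorm_on_nonneg[OF p U, of y] by force
  have "p y * norm x \<le> p x" if x: "x \<in> U" for x
  proof (cases "x = 0")
    case False
    have "of_real (1 / norm x) *s x \<in> U \<inter> sphere 0 1"
      using vec.subspace_scale[OF U x] False by (auto simp: norm_vector_smult norm_divide)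
    from min[OF this] have "p y \<le> p x / norm x"
      by (simp add: seminorm_on_smult[OF p x] norm_divide)
    then show ?thesis
      using False by (simp add: field_simps)
  qed (use seminorm_on_zero[OF p U] in auto)
  with py that show ?thesis by blast
qed

section \<open>Auerbach bases\<close>

lemma continuous_on_det: "continuous_on S (det :: 'a::real_normed_field ^ 'n ^ 'n \<Rightarrow> 'a)"
  unfolding det_def[abs_def] by (intro continuous_intros)

lemma indexed_basis:
  fixes B :: "('a::field ^ 'n) set"
  assumes B: "vec.independent B" "vec.span B = UNIV"
  obtains f :: "'n \<Rightarrow> 'a ^ 'n" where "bij_betw f UNIV B"
    "\<And>c. (\<Sum>i\<in>UNIV. c i *s f i) = 0 \<Longrightarrow> \<forall>i. c i = 0"
proof -
  have finB: "finite B"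
    using B(1) vec.finiteI_independent by blast
  have "card B = CARD('n)"
    using vec.dim_eq_card[of B UNIV] B vec_dim_card[where 'a='a and 'n='n] by (simp del: vec.dim_UNIV)
  then obtain f :: "'n \<Rightarrow> 'a ^ 'n" where f: "bij_betw f UNIV B"
    using finB finite_same_card_bij by (metis finite_class.finite_UNIV)
  have inj: "inj f" using f bij_betw_def by blast
  have "\<forall>i. c i = 0" if "(\<Sum>i\<in>UNIV. c i *s f i) = 0" for c
  proof -
    have "(\<Sum>v\<in>B. c (inv f v) *s v) = (\<Sum>i\<in>UNIV. c i *s f i)"
      by (subst sum.reindex_bij_betw[OF f, symmetric]) (simp add: inj)
    then have "\<forall>v\<in>B. c (inv f v) = 0"
      using that B(1) unfolding vec.independent_explicit by auto
    then show ?thesis using f inj by (metis bij_betwE inv_f_f UNIV_I)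
  qed
  with f that show ?thesis by blast
qed

text \<open>Among the tuples of vectors in the unit ball of \<open>p\<close>, one that spans a parallelepiped of maximal
  volume works: by Cramer's rule a coordinate of \<open>x\<close> is the factor by which the volume changes when
  the corresponding basis vector is replaced by \<open>x\<close>. To speak of determinants although \<open>U\<close> may be a
  proper subspace, the tuples are completed by fixed vectors to the rows of a square matrix; the rows
  that vary are those with index in \<open>J\<close>.\<close>

lemma auerbach_basis:
  fixes U :: "('a::{real_normed_field,euclidean_space} ^ 'n) set"
  assumes U: "vec.subspace U" and p: "seminorm_on U p"
    and pos: "\<And>x. x \<in> U \<Longrightarrow> p x = 0 \<Longrightarrow> x = 0"
  obtains E where "vec.independent E" "vec.span E = U" "\<And>e. e \<in> E \<Longrightarrow> p e \<le> 1"
    "\<And>x e. x \<in> U \<Longrightarrow> e \<in> E \<Longrightarrow> norm (vec.representation E x e) \<le> p x"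
proof -
  obtain B0 where B0: "B0 \<subseteq> U" "vec.independent B0" "U \<subseteq> vec.span B0"
    using vec.maximal_independent_subset by blast
  define B where "B = vec.extend_basis B0"
  have B: "B0 \<subseteq> B" "vec.independent B" "vec.span B = UNIV"
    unfolding B_def using B0(2)
    by (rule vec.extend_basis_superset vec.independent_extend_basis vec.span_extend_basis)+
  obtain f :: "'n \<Rightarrow> 'a ^ 'n" where f: "bij_betw f UNIV B"
    and indf: "\<And>c. (\<Sum>i\<in>UNIV. c i *s f i) = 0 \<Longrightarrow> \<forall>i. c i = 0"
    using indexed_basis[OF B(2,3)] by blast
  define J where "J = {j. f j \<in> B0}"
  have J: "f ` J = B0"
    using f B(1) unfolding J_def bij_betw_def by auto
  have inj: "inj f" using f bij_betw_def by blast
  define C where "C j = (if j \<in> J then {x \<in> U. p x \<le> 1} else {f j})" for j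
  define K where "K = {T :: 'a ^ 'n ^ 'n. \<forall>j. T $ j \<in> C j}"
  have contp: "continuous_on U p"
    by (rule seminorm_on_continuous_on[OF U p])
  obtain c where c: "c > 0" "\<And>x. x \<in> U \<Longrightarrow> c * norm x \<le> p x"
    using norm_on_ge_norm[OF U p pos] by blast
  have "compact {x \<in> U. p x \<le> 1}"
  proof -
    have "norm x \<le> 1 / c" if "x \<in> U" "p x \<le> 1" for x
      using c(2)[OF that(1)] that(2) c(1) by (simp add: field_simps)
    then have "bounded {x \<in> U. p x \<le> 1}"
      unfolding bounded_iff by blast
    moreover have "closed {x \<in> U. p x \<le> 1}"
      using continuous_closed_preimage[OF contp closed_vec_subspace[OF U], of "{..1}"]
      by (simp add: vimage_def Int_def)
    ultimately show ?thesis by (simp add: compact_eq_bounded_closed)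
  qed
  then have "compact (C j)" for j
    by (simp add: C_def)
  then have compK: "compact K"
    unfolding K_def by (rule compact_vec_box)

  \<comment> \<open>\<open>K\<close> contains a nonsingular matrix, so the maximal determinant is not zero.\<close>
  define T0 where "T0 = (\<chi> j. (if j \<in> J then of_real (1 / p (f j)) else 1) *s f j)"
  have f0: "f j \<noteq> 0" for j
    using f B(2) vec.dependent_zero by (metis bij_betwE UNIV_I)
  have fJ: "f j \<in> U" "p (f j) > 0" if "j \<in> J" for j
  proof -
    show "f j \<in> U" using that B0(1) J_def by auto
    then show "p (f j) > 0"
      using pos[of "f j"] f0[of j] seminorm_on_nonneg[OF p U, of "f j"] by force
  qed
  have sgn1: "y / \<bar>y\<bar> \<le> 1" for y :: real
    by (cases "y = 0") (auto simp: divide_le_eq_1)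
  have T0K: "T0 \<in> K"
    unfolding K_def C_def T0_def using fJ sgn1
    by (auto simp: vec.subspace_scale[OF U] seminorm_on_smult[OF p] norm_divide)
  have detT0: "det T0 \<noteq> 0"
  proof -
    have "\<forall>i. a i = 0" if "(\<Sum>i\<in>UNIV. a i *s row i T0) = 0" for a
    proof -
      have "(\<Sum>i\<in>UNIV. (a i * (if i \<in> J then of_real (1 / p (f i)) else 1)) *s f i) = 0"
        using that by (simp add: row_eq_nth T0_def)
      from indf[OF this] show ?thesis
        using fJ(2) by (metis divide_eq_0_iff less_numeral_extra(3) mult_eq_0_iff of_real_eq_0_iff zero_neq_one)
    qed
    then show ?thesis
      using matrix_right_invertible_independent_rows[of T0] invertible_right_inverse invertible_det_nz
      by blast
  qed
  obtain T where T: "T \<in> K" and max: "\<And>T'. T' \<in> K \<Longrightarrow> norm (det T') \<le> norm (det T)"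
    using continuous_attains_sup[OF compK, of "\<lambda>T. norm (det T)"] T0K
      continuous_on_norm[OF continuous_on_det] by blast
  have detT: "det T \<noteq> 0"
    using max[OF T0K] detT0 by auto
  have TJ: "T $ j \<in> U" "p (T $ j) \<le> 1" if "j \<in> J" for j
    using T that unfolding K_def C_def by (auto dest!: spec[of _ j])
  have TnJ: "T $ j = f j" if "j \<notin> J" for j
    using T that unfolding K_def C_def by (auto dest!: spec[of _ j])

  have indT: "\<forall>i. a i = 0" if "(\<Sum>i\<in>UNIV. a i *s T $ i) = 0" for a
  proof -
    have "\<exists>B. T ** B = mat 1"
      using detT invertible_det_nz invertible_right_inverse by blast
    then show ?thesis
      using that unfolding matrix_right_invertible_independent_rows row_eq_nth by simp
  qed
  have injT: "inj (($) T)"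
  proof (rule injI, rule ccontr)
    fix i j assume ij: "T $ i = T $ j" "i \<noteq> j"
    then show False
      using det_identical_rows[of i j T] detT by (simp add: row_eq_nth)
  qed
  define E where "E = ($) T ` J"
  have finE: "finite E" by (simp add: E_def)
  have EU: "E \<subseteq> U" using TJ E_def by auto
  have sumE: "(\<Sum>v\<in>E. a v *s v) = (\<Sum>i\<in>UNIV. (if i \<in> J then a (T $ i) else 0) *s T $ i)" for a
  proof -
    have "(\<Sum>v\<in>E. a v *s v) = (\<Sum>i\<in>J. a (T $ i) *s T $ i)"
      unfolding E_def by (subst sum.reindex) (auto intro: inj_on_subset[OF injT])
    also have "\<dots> = (\<Sum>i\<in>UNIV. (if i \<in> J then a (T $ i) else 0) *s T $ i)"
      by (rule sum.mono_neutral_cong_left) auto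
    finally show ?thesis .
  qed
  have indE: "vec.independent E"
    unfolding vec.independent_explicit
  proof (intro conjI allI impI ballI finE)
    fix a v assume a: "(\<Sum>v\<in>E. a v *s v) = 0" and "v \<in> E"
    then obtain j where "j \<in> J" "v = T $ j" by (auto simp: E_def)
    moreover have "\<forall>i. (if i \<in> J then a (T $ i) else 0) = 0"
      using a unfolding sumE by (rule indT)
    ultimately show "a v = 0" by metis
  qed
  have spanE: "vec.span E = U"
  proof -
    have "card E = card J"
      unfolding E_def by (rule card_image) (rule inj_on_subset[OF injT subset_UNIV])
    also have "\<dots> = card B0"
      unfolding J[symmetric] by (rule card_image[symmetric]) (rule inj_on_subset[OF inj subset_UNIV])
    also have "\<dots> = vec.dim U"
      using B0 vec.basis_card_eq_dim by blast
    finally have "U \<subseteq> vec.span E"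
      using vec.card_ge_dim_independent[OF EU indE] by simp
    then show ?thesis
      using vec.span_minimal[OF EU U] by blast
  qed
  have "norm (vec.representation E x e) \<le> p x" if x: "x \<in> U" and e: "e \<in> E" for x e
  proof (cases "x = 0")
    case True
    then show ?thesis
      using seminorm_on_zero[OF p U] by (simp add: vec.representation_zero)
  next
    case False
    obtain k where k: "k \<in> J" "e = T $ k" using e E_def by auto
    define a where "a = (\<chi> i. if i \<in> J then vec.representation E x (T $ i) else 0)"
    have xs: "x = (\<Sum>i\<in>UNIV. a $ i *s row i T)"
    proof -
      have "x = (\<Sum>v\<in>E. vec.representation E x v *s v)"
        using vec.sum_representation_eq[OF indE _ finE subset_refl] x spanE by simp
      then show ?thesis unfolding sumE by (simp add: a_def row_eq_nth)
    qed
    have px: "p x > 0"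
      using pos[OF x] False seminorm_on_nonneg[OF p U x] by force
    define T' where "T' = (\<chi> i. if i = k then of_real (1 / p x) *s x else row i T)"
    have "T' \<in> K"
      using TJ TnJ k(1) px x unfolding K_def C_def T'_def
      by (auto simp: vec.subspace_scale[OF U] seminorm_on_smult[OF p] norm_divide row_eq_nth)
    then have "norm (det T') \<le> norm (det T)" by (rule max)
    moreover have "det T' = of_real (1 / p x) * (a $ k * det T)"
      unfolding T'_def det_row_mul by (subst xs) (simp add: cramer_lemma_transpose)
    ultimately have "norm (a $ k) / p x * norm (det T) \<le> 1 * norm (det T)"
      using px by (simp add: norm_mult norm_divide)
    then have "norm (a $ k) / p x \<le> 1"
      using detT mult_le_cancel_right_pos by (metis zero_less_norm_iff)
    then show ?thesis
      using px k by (simp add: a_def field_simps)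
  qed
  then show ?thesis
    using that[OF indE spanE] TJ E_def by blast
qed

section \<open>Growth of products and the joint spectral radius\<close>

text \<open>Fekete's lemma in multiplicative form. The limit is the infimum of the roots, and the growth bound
  is part of the usual proof: if the \<open>m\<close>-th root is below \<open>s\<close>, division of \<open>t\<close> by \<open>m\<close> with remainder
  bounds \<open>a t\<close> by a constant times \<open>s ^ t\<close>.\<close>

lemma fekete_root:
  fixes a :: "nat \<Rightarrow> real"
  assumes nonneg: "\<And>t. 0 \<le> a t" and submult: "\<And>m n. a (m + n) \<le> a m * a n"
  obtains L where "0 \<le> L" "(\<lambda>t. root t (a t)) \<longlonglongrightarrow> L" "\<And>s. s > L \<Longrightarrow> \<exists>C. \<forall>t. a t \<le> C * s ^ t"
proof -
  define R where "R = (\<lambda>t. root t (a t)) ` {1..}"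
  define L where "L = Inf R"
  have R0: "0 \<le> y" if "y \<in> R" for y
    using that nonneg unfolding R_def by auto
  have Rne: "R \<noteq> {}" unfolding R_def by auto
  have bdd: "bdd_below R" using R0 by (auto simp: bdd_below_def)
  have L0: "0 \<le> L" unfolding L_def using R0 Rne by (intro cInf_greatest)
  have Lle: "L \<le> root t (a t)" if "t \<ge> 1" for t
    unfolding L_def by (rule cInf_lower[OF _ bdd]) (use that R_def in auto)
  have growth: "\<exists>C. \<forall>t. a t \<le> C * s ^ t" if s: "s > L" for s
  proof -
    have s0: "s > 0" using s L0 by simp
    obtain m where m: "m \<ge> 1" "root m (a m) < s"
      using cInf_lessD[OF Rne, of s] s unfolding L_def R_def by auto
    have "a m = root m (a m) ^ m"
      using m nonneg by (simp add: real_root_pow_pos2)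
    also have "\<dots> \<le> s ^ m"
      using m nonneg by (intro power_mono) auto
    finally have am: "a m \<le> s ^ m" .
    have iter: "a (q * m + k) \<le> s ^ (q * m) * a k" for q k
    proof (induction q)
      case (Suc q)
      have "a (Suc q * m + k) \<le> a m * a (q * m + k)"
        using submult[of m "q * m + k"] by (simp add: add.assoc)
      also have "\<dots> \<le> s ^ m * (s ^ (q * m) * a k)"
        using am Suc nonneg s0 by (intro mult_mono) auto
      finally show ?case by (simp add: power_add mult.assoc)
    qed simp
    define C where "C = (\<Sum>k<m. a k / s ^ k)"
    have "a t \<le> C * s ^ t" for t
    proof -
      define k where "k = t mod m"
      have t: "t = t div m * m + k" by (simp add: k_def)
      have "k < m" using m k_def by auto
      then have "a k / s ^ k \<le> C"
        unfolding C_def using nonneg s0 by (intro member_le_sum) auto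
      then have "a k \<le> C * s ^ k"
        using s0 by (simp add: field_simps)
      then have "s ^ (t div m * m) * a k \<le> s ^ (t div m * m) * (C * s ^ k)"
        using s0 by (intro mult_left_mono) auto
      also have "\<dots> = C * s ^ (t div m * m + k)"
        by (simp add: power_add)
      finally show ?thesis
        using iter[of "t div m" k] t[symmetric] by simp
    qed
    then show ?thesis by blast
  qed
  have "(\<lambda>t. root t (a t)) \<longlonglongrightarrow> L"
  proof (rule order_tendstoI)
    fix y assume "y < L"
    then show "\<forall>\<^sub>F t in sequentially. y < root t (a t)"
      using Lle by (intro eventually_sequentiallyI[of 1]) force
  next
    fix y assume y: "L < y"
    define s where "s = (L + y) / 2"
    have s: "L < s" "s < y" "0 < s" using y L0 by (auto simp: s_def)
    obtain C where C: "\<And>t. a t \<le> C * s ^ t" using growth[OF s(1)] by blast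
    have D: "a t \<le> (\<bar>C\<bar> + 1) * s ^ t" for t
      using C[of t] s(3) by (smt (verit) mult_right_mono zero_le_power)
    have "(\<lambda>t. root t (\<bar>C\<bar> + 1) * s) \<longlonglongrightarrow> 1 * s"
      by (intro tendsto_mult LIMSEQ_root_const tendsto_const) simp
    then have "\<forall>\<^sub>F t in sequentially. root t (\<bar>C\<bar> + 1) * s < y"
      using s(2) by (auto dest: order_tendstoD(2))
    then show "\<forall>\<^sub>F t in sequentially. root t (a t) < y"
      using eventually_ge_at_top[of 1]
    proof eventually_elim
      case (elim t)
      have "root t (a t) \<le> root t ((\<bar>C\<bar> + 1) * s ^ t)"
        using D elim by (intro real_root_le_mono) auto
      also have "\<dots> = root t (\<bar>C\<bar> + 1) * s"
        using elim s by (simp add: real_root_mult real_root_power_cancel)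
      finally show ?case using elim by simp
    qed
  qed
  with that L0 growth show ?thesis by blast
qed

lemma mat_product_cong: "(\<And>s. s < t \<Longrightarrow> A s = A' s) \<Longrightarrow> mat_product A t = mat_product A' t"
  by (induction t) auto

lemma products_of_length_0: "products_of_length M 0 = {mat 1}"
  by (auto simp: products_of_length_def)

lemma products_of_length_Suc:
  "products_of_length M (Suc t) = {A ** S | A S. A \<in> M \<and> S \<in> products_of_length M t}"
proof (intro subset_antisym subsetI)
  fix X assume "X \<in> {A ** S | A S. A \<in> M \<and> S \<in> products_of_length M t}"
  then obtain A f where A: "X = A ** mat_product f t" "A \<in> M" "\<forall>s<t. f s \<in> M"
    by (auto simp: products_of_length_def)
  have "mat_product (f(t := A)) t = mat_product f t"
    by (rule mat_product_cong) simp
  then have "X = mat_product (f(t := A)) (Suc t)"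
    using A by simp
  moreover have "\<forall>s<Suc t. (f(t := A)) s \<in> M"
    using A by (auto simp: less_Suc_eq)
  ultimately show "X \<in> products_of_length M (Suc t)"
    unfolding products_of_length_def by blast
qed (force simp: products_of_length_def)

lemma products_of_length_1: "products_of_length M (Suc 0) = M"
  by (auto simp: products_of_length_Suc products_of_length_0)

lemma products_of_length_add:
  "products_of_length M (m + n) =
     {S2 ** S1 | S1 S2. S1 \<in> products_of_length M m \<and> S2 \<in> products_of_length M n}"
proof (induction n)
  case (Suc n)
  then show ?case
    by (simp add: products_of_length_Suc) (safe; metis matrix_mul_assoc)
qed (simp add: products_of_length_0)

lemma products_of_length_nonempty: "M \<noteq> {} \<Longrightarrow> products_of_length M t \<noteq> {}"
  by (induction t) (auto simp: products_of_length_0 products_of_length_Suc)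

lemma spectral_norm_nonneg:
  fixes A :: "'a::{real_normed_field,euclidean_space} ^ 'n ^ 'n"
  shows "0 \<le> spectral_norm A"
  unfolding spectral_norm_def by (rule onorm_pos_le) simp

lemma norm_matrix_vector_le:
  fixes A :: "'a::{real_normed_field,euclidean_space} ^ 'n ^ 'n"
  shows "norm (A *v x) \<le> spectral_norm A * norm x"
  unfolding spectral_norm_def by (rule onorm) simp

lemma spectral_norm_mult_le:
  fixes A B :: "'a::{real_normed_field,euclidean_space} ^ 'n ^ 'n"
  shows "spectral_norm (A ** B) \<le> spectral_norm A * spectral_norm B"
  unfolding spectral_norm_def
  using onorm_compose[of "(*v) A" "(*v) B"] by (simp add: o_def matrix_vector_mul_assoc)

text \<open>All that the construction of the basis uses about \<open>r = \<rho>(M)\<close>, apart from its sign.\<close>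

definition growth_rate_le :: "('a::real_normed_field ^ 'n ^ 'n) set \<Rightarrow> real \<Rightarrow> bool" where
  "growth_rate_le M r \<longleftrightarrow>
     (\<forall>s>r. \<exists>C. \<forall>t. \<forall>S\<in>products_of_length M t. \<forall>x. norm (S *v x) \<le> C * s ^ t * norm x)"

lemma bounded_imp_spectral_norm_bounded:
  fixes M :: "('a::{real_normed_field,euclidean_space} ^ 'n ^ 'n) set"
  assumes "bounded M"
  obtains K where "K \<ge> 0" "\<And>A. A \<in> M \<Longrightarrow> spectral_norm A \<le> K"
proof -
  obtain b where b: "\<And>A. A \<in> M \<Longrightarrow> norm A \<le> b"
    using assms bounded_iff by blast
  define K where "K = (\<Sum>i\<in>(UNIV::'n set). \<Sum>j\<in>(UNIV::'n set). \<bar>b\<bar>)"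
  have "spectral_norm A \<le> K" if "A \<in> M" for A
    unfolding spectral_norm_def
  proof (rule onorm_le)
    fix x
    have e: "norm (A $ i $ j) \<le> \<bar>b\<bar>" for i j
      using Finite_Cartesian_Product.norm_nth_le[of "A $ i" j]
        Finite_Cartesian_Product.norm_nth_le[of A i] b[OF that] by linarith
    have "norm (A *v x) \<le> (\<Sum>i\<in>UNIV. norm ((A *v x) $ i))"
      unfolding norm_vec_def by (rule L2_set_le_sum) simp
    also have "\<dots> \<le> (\<Sum>i\<in>(UNIV::'n set). \<Sum>j\<in>(UNIV::'n set). \<bar>b\<bar> * norm x)"
    proof (rule sum_mono)
      fix i
      have "norm ((A *v x) $ i) \<le> (\<Sum>j\<in>UNIV. norm (A $ i $ j * x $ j))"
        unfolding matrix_vector_mult_def by (simp add: norm_sum)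
      also have "\<dots> \<le> (\<Sum>j\<in>(UNIV::'n set). \<bar>b\<bar> * norm x)"
        unfolding norm_mult
        by (intro sum_mono mult_mono e Finite_Cartesian_Product.norm_nth_le) auto
      finally show "norm ((A *v x) $ i) \<le> (\<Sum>j\<in>(UNIV::'n set). \<bar>b\<bar> * norm x)" .
    qed
    finally show "norm (A *v x) \<le> K * norm x"
      by (simp add: K_def)
  qed
  moreover have "K \<ge> 0" unfolding K_def by (intro sum_nonneg) auto
  ultimately show ?thesis using that by blast
qed

lemma growth_rate_joint_spectral_radius:
  fixes M :: "('a::{real_normed_field,euclidean_space} ^ 'n ^ 'n) set"
  assumes "M \<noteq> {}" "bounded M"
  shows "growth_rate_le M (joint_spectral_radius M)"
proof -
  obtain K where K: "K \<ge> 0" "\<And>A. A \<in> M \<Longrightarrow> spectral_norm A \<le> K"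
    using bounded_imp_spectral_norm_bounded[OF assms(2)] by blast
  have "\<exists>b. \<forall>S\<in>products_of_length M t. spectral_norm S \<le> b" for t
  proof (induction t)
    case 0
    then show ?case by (auto simp: products_of_length_0)
  next
    case (Suc t)
    then obtain b where b: "\<And>S. S \<in> products_of_length M t \<Longrightarrow> spectral_norm S \<le> b" by blast
    have "spectral_norm (A ** S) \<le> K * b" if "A \<in> M" "S \<in> products_of_length M t" for A S
      using spectral_norm_mult_le[of A S] mult_mono[OF K(2)[OF that(1)] b[OF that(2)] K(1) spectral_norm_nonneg]
      by linarith
    then show ?case unfolding products_of_length_Suc by blast
  qed
  then have bdd: "bdd_above (spectral_norm ` products_of_length M t)" for t
    unfolding bdd_above_def by blast
  define a where "a t = (SUP S\<in>products_of_length M t. spectral_norm S)" for t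
  have upper: "spectral_norm S \<le> a t" if "S \<in> products_of_length M t" for S t
    unfolding a_def by (rule cSUP_upper[OF that bdd])
  have a0: "0 \<le> a t" for t
    using products_of_length_nonempty[OF assms(1)] upper spectral_norm_nonneg order_trans
    by (metis all_not_in_conv)
  have submult: "a (m + n) \<le> a m * a n" for m n
    unfolding a_def[of "m + n"]
  proof (rule cSUP_least[OF products_of_length_nonempty[OF assms(1)]])
    fix S assume "S \<in> products_of_length M (m + n)"
    then obtain S1 S2 where S: "S = S2 ** S1" "S1 \<in> products_of_length M m" "S2 \<in> products_of_length M n"
      unfolding products_of_length_add by blast
    have "spectral_norm S \<le> spectral_norm S2 * spectral_norm S1"
      unfolding S(1) by (rule spectral_norm_mult_le)
    also have "\<dots> \<le> a n * a m"
      using S by (intro mult_mono upper a0 spectral_norm_nonneg)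
    finally show "spectral_norm S \<le> a m * a n" by (simp add: mult.commute)
  qed
  obtain L where L: "(\<lambda>t. root t (a t)) \<longlonglongrightarrow> L" "\<And>s. s > L \<Longrightarrow> \<exists>C. \<forall>t. a t \<le> C * s ^ t"
    using fekete_root[of a] a0 submult by metis
  have "joint_spectral_radius M = L"
    unfolding joint_spectral_radius_def using limI[OF L(1)] by (simp add: a_def)
  moreover have "growth_rate_le M L"
    unfolding growth_rate_le_def
  proof (intro allI impI)
    fix s assume "s > L"
    then obtain C where C: "\<And>t. a t \<le> C * s ^ t" using L(2) by blast
    have "norm (S *v x) \<le> C * s ^ t * norm x" if "S \<in> products_of_length M t" for S t x
      using norm_matrix_vector_le[of S x] mult_right_mono[OF order_trans[OF upper[OF that] C] norm_ge_zero[of x]]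
      by linarith
    then show "\<exists>C. \<forall>t. \<forall>S\<in>products_of_length M t. \<forall>x. norm (S *v x) \<le> C * s ^ t * norm x"
      by blast
  qed
  ultimately show ?thesis by simp
qed

section \<open>Invariant seminorms\<close>

definition damped_norm :: "('a::real_normed_field ^ 'n ^ 'n) set \<Rightarrow> real \<Rightarrow> 'a ^ 'n \<Rightarrow> real" where
  "damped_norm M s x = Sup {norm (S *v x) / s ^ t | S t. S \<in> products_of_length M t}"

context
  fixes M :: "('a::{real_normed_field,euclidean_space} ^ 'n ^ 'n) set" and r s :: real
  assumes growth: "growth_rate_le M r" and r: "0 \<le> r" and s: "r < s"
begin

private lemma s_pos: "0 < s" using r s by simp

private lemma damped_norm_upper:
  assumes "S \<in> products_of_length M t"
  shows "norm (S *v x) \<le> damped_norm M s x * s ^ t"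
proof -
  obtain C where C: "\<And>t S x. S \<in> products_of_length M t \<Longrightarrow> norm (S *v x) \<le> C * s ^ t * norm x"
    using growth s unfolding growth_rate_le_def by blast
  have "norm (S *v x) / s ^ t \<le> C * norm x" if "S \<in> products_of_length M t" for S t
    using C[OF that, of x] s_pos by (simp add: field_simps)
  then have "bdd_above {norm (S *v x) / s ^ t | S t. S \<in> products_of_length M t}"
    unfolding bdd_above_def by blast
  then have "norm (S *v x) / s ^ t \<le> damped_norm M s x"
    unfolding damped_norm_def using assms by (intro cSup_upper) auto
  then show ?thesis
    using s_pos by (simp add: field_simps)
qed

private lemma damped_norm_least:
  assumes "\<And>S t. S \<in> products_of_length M t \<Longrightarrow> norm (S *v x) \<le> b * s ^ t"
  shows "damped_norm M s x \<le> b"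
  unfolding damped_norm_def
proof (rule cSup_least)
  show "{norm (S *v x) / s ^ t | S t. S \<in> products_of_length M t} \<noteq> {}"
    using products_of_length_0[of M] by blast
next
  fix y assume "y \<in> {norm (S *v x) / s ^ t | S t. S \<in> products_of_length M t}"
  then show "y \<le> b"
    using assms s_pos by (auto simp: divide_le_eq)
qed

lemma norm_le_damped_norm: "norm x \<le> damped_norm M s x"
  using damped_norm_upper[of "mat 1" 0 x] by (simp add: products_of_length_0)

lemma seminorm_damped_norm: "seminorm_on UNIV (damped_norm M s)"
proof (rule seminorm_onI)
  fix x y :: "'a ^ 'n"
  show "damped_norm M s (x + y) \<le> damped_norm M s x + damped_norm M s y"
  proof (rule damped_norm_least)
    fix S t assume S: "S \<in> products_of_length M t"
    have "norm (S *v (x + y)) \<le> norm (S *v x) + norm (S *v y)"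
      by (simp add: matrix_vector_right_distrib norm_triangle_ineq)
    then show "norm (S *v (x + y)) \<le> (damped_norm M s x + damped_norm M s y) * s ^ t"
      using damped_norm_upper[OF S, of x] damped_norm_upper[OF S, of y] by (simp add: distrib_right)
  qed
next
  fix c and x :: "'a ^ 'n"
  show "damped_norm M s (c *s x) \<le> norm c * damped_norm M s x"
  proof (rule damped_norm_least)
    fix S t assume S: "S \<in> products_of_length M t"
    have "norm (S *v (c *s x)) = norm c * norm (S *v x)"
      by (simp add: vec.scale norm_vector_smult)
    also have "\<dots> \<le> norm c * (damped_norm M s x * s ^ t)"
      by (intro mult_left_mono damped_norm_upper S) simp
    finally show "norm (S *v (c *s x)) \<le> norm c * damped_norm M s x * s ^ t"
      by (simp add: mult.assoc)
  qed
qed simp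

text \<open>If \<open>S\<close> is a product of length \<open>t\<close>, then \<open>S ** A\<close> is one of length \<open>t + 1\<close>, whose damping factor
  differs by \<open>s\<close>.\<close>

lemma damped_norm_matrix_le:
  assumes "A \<in> M"
  shows "damped_norm M s (A *v x) \<le> s * damped_norm M s x"
proof (rule damped_norm_least)
  fix S t assume S: "S \<in> products_of_length M t"
  have "S ** A \<in> products_of_length M (Suc 0 + t)"
    unfolding products_of_length_add products_of_length_1 using S assms by blast
  from damped_norm_upper[OF this, of x]
  show "norm (S *v (A *v x)) \<le> s * damped_norm M s x * s ^ t"
    by (simp add: matrix_vector_mul_assoc mult.assoc mult.left_commute)
qed

end

text \<open>The limes superior of the normalised norms \<open>q s\<close> as \<open>s\<close> decreases to \<open>r\<close>. It is written as the
  infimum of the eventual upper bounds, which gives subadditivity, homogeneity and invariance by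
  adding and scaling eventual bounds (\<open>p_le\<close>, \<open>p_gt\<close>).\<close>

lemma invariant_seminorm:
  fixes M :: "('a::{real_normed_field,euclidean_space} ^ 'n ^ 'n) set"
  assumes growth: "growth_rate_le M r" and r: "0 \<le> r"
    and V: "vec.subspace V" and V0: "V \<noteq> {0}"
    and inv: "\<And>A x. A \<in> M \<Longrightarrow> x \<in> V \<Longrightarrow> A *v x \<in> V"
  obtains p where "seminorm_on V p" "\<And>A x. A \<in> M \<Longrightarrow> x \<in> V \<Longrightarrow> p (A *v x) \<le> r * p x"
    "\<exists>x\<in>V. p x \<noteq> 0"
proof -
  obtain B where B: "B \<subseteq> V" "vec.independent B" "V \<subseteq> vec.span B"
    using vec.maximal_independent_subset by blast
  have finB: "finite B" using B(2) vec.finiteI_independent by blast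
  have spanB: "vec.span B = V" using B vec.span_minimal[OF B(1) V] by blast
  have Bne: "B \<noteq> {}" using spanB V0 by auto
  define N where "N = damped_norm M"
  define d where "d s = (\<Sum>b\<in>B. N s b)" for s
  define q where "q s x = N s x / d s" for s x
  have semN: "seminorm_on UNIV (N s)" if "s > r" for s
    unfolding N_def by (rule seminorm_damped_norm[OF growth r that])
  have N0: "0 \<le> N s x" if "s > r" for s x
    using seminorm_on_nonneg[OF semN[OF that]] by simp
  have d_pos: "d s > 0" if "s > r" for s
    unfolding d_def
  proof (rule sum_pos[OF finB Bne])
    fix b assume "b \<in> B"
    then have "b \<noteq> 0" using B(2) vec.dependent_zero by blast
    then show "0 < N s b"
      using norm_le_damped_norm[OF growth r that, of b] unfolding N_def
      by (meson less_le_trans zero_less_norm_iff)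
  qed
  have semq: "seminorm_on UNIV (q s)" if "s > r" for s
    using semN[OF that] d_pos[OF that] unfolding seminorm_on_def q_def
    by (auto simp: add_divide_distrib[symmetric] divide_right_mono)
  have q0: "0 \<le> q s x" if "s > r" for s x
    using seminorm_on_nonneg[OF semq[OF that]] by simp
  have qB: "q s b \<le> 1" if "s > r" "b \<in> B" for s b
    using member_le_sum[OF that(2), of "N s"] N0[OF that(1)] finB d_pos[OF that(1)]
    unfolding q_def d_def[symmetric] by (simp add: divide_le_eq_1)
  have qsum: "(\<Sum>b\<in>B. q s b) = 1" if "s > r" for s
    using d_pos[OF that] unfolding q_def sum_divide_distrib[symmetric] d_def[symmetric] by simp
  have ev_r: "\<forall>\<^sub>F s in at_right r. s > r"
    by (simp add: eventually_at_right_less)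
  \<comment> \<open>Expansion in \<open>B\<close> bounds \<open>q s x\<close> uniformly in \<open>s\<close>, since \<open>q s\<close> is at most \<open>1\<close> on \<open>B\<close>.\<close>
  have q_bound: "\<exists>c. \<forall>\<^sub>F s in at_right r. q s x \<le> c" if "x \<in> V" for x
  proof -
    have "q s x \<le> (\<Sum>b\<in>B. norm (vec.representation B x b))" if s: "s > r" for s
    proof -
      have "x = (\<Sum>b\<in>B. vec.representation B x b *s b)"
        using vec.sum_representation_eq[OF B(2) _ finB subset_refl] \<open>x \<in> V\<close> spanB by simp
      then have "q s x \<le> (\<Sum>b\<in>B. q s (vec.representation B x b *s b))"
        using seminorm_on_sum[OF semq[OF s], of B "\<lambda>b. vec.representation B x b *s b"] by simp
      also have "\<dots> \<le> (\<Sum>b\<in>B. norm (vec.representation B x b) * 1)"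
        unfolding seminorm_on_smult[OF semq[OF s] UNIV_I]
        by (intro sum_mono mult_left_mono qB s) auto
      finally show ?thesis by simp
    qed
    then show ?thesis
      by (intro exI) (rule eventually_mono[OF ev_r])
  qed

  define p where "p x = Inf {c. \<forall>\<^sub>F s in at_right r. q s x \<le> c}" for x
  have q_ev_nonneg: "0 \<le> c" if "\<forall>\<^sub>F s in at_right r. q s x \<le> c" for c x
  proof -
    have "\<forall>\<^sub>F s in at_right r. 0 \<le> c"
      using that ev_r by eventually_elim (use q0 order_trans in blast)
    then show ?thesis
      by simp
  qed
  have p_le: "p x \<le> c" if "\<forall>\<^sub>F s in at_right r. q s x \<le> c" for x c
    unfolding p_def by (rule cInf_lower) (use that q_ev_nonneg in \<open>auto simp: bdd_below_def\<close>)
  have p_gt: "\<forall>\<^sub>F s in at_right r. q s x \<le> c" if x: "x \<in> V" and c: "p x < c" for x c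
  proof -
    obtain c' where "c' < c" "\<forall>\<^sub>F s in at_right r. q s x \<le> c'"
      using cInf_lessD[of "{c. \<forall>\<^sub>F s in at_right r. q s x \<le> c}" c] q_bound[OF x] c
      unfolding p_def by auto
    then show ?thesis
      by (auto elim: eventually_mono)
  qed
  have sem: "seminorm_on V p"
  proof (rule seminorm_onI[OF V])
    fix x y assume xy: "x \<in> V" "y \<in> V"
    show "p (x + y) \<le> p x + p y"
    proof (rule field_le_epsilon)
      fix e :: real assume e: "e > 0"
      have "\<forall>\<^sub>F s in at_right r. q s x \<le> p x + e / 2" "\<forall>\<^sub>F s in at_right r. q s y \<le> p y + e / 2"
        using xy e by (auto intro!: p_gt)
      then have "\<forall>\<^sub>F s in at_right r. q s (x + y) \<le> p x + p y + e"
        using ev_r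
      proof eventually_elim
        case (elim s)
        then show ?case using seminorm_on_add[OF semq, of s x y] by simp
      qed
      then show "p (x + y) \<le> p x + p y + e" by (rule p_le)
    qed
  next
    fix c and x assume x: "x \<in> V"
    show "p (c *s x) \<le> norm c * p x"
    proof (rule field_le_epsilon)
      fix e :: real assume e: "e > 0"
      have cpos: "norm c + 1 > 0" by (smt (verit) norm_ge_zero)
      have "\<forall>\<^sub>F s in at_right r. q s x \<le> p x + e / (norm c + 1)"
        using x e cpos by (auto intro!: p_gt)
      then have "\<forall>\<^sub>F s in at_right r. q s (c *s x) \<le> norm c * p x + e"
        using ev_r
      proof eventually_elim
        case (elim s)
        have "q s (c *s x) = norm c * q s x"
          using seminorm_on_smult[OF semq[OF elim(2)]] by simp
        also have "\<dots> \<le> norm c * (p x + e / (norm c + 1))"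
          using elim by (intro mult_left_mono) auto
        also have "\<dots> \<le> norm c * p x + e"
          using e cpos by (simp add: field_simps)
        finally show ?case .
      qed
      then show "p (c *s x) \<le> norm c * p x + e" by (rule p_le)
    qed
  qed
  have p_mat: "p (A *v x) \<le> r * p x" if A: "A \<in> M" and x: "x \<in> V" for A x
  proof -
    have *: "p (A *v x) \<le> (r + e) * (p x + e)" if e: "e > 0" for e
    proof (rule p_le)
      have "\<forall>\<^sub>F s in at_right r. q s x \<le> p x + e"
        using x e by (auto intro!: p_gt)
      moreover have "\<forall>\<^sub>F s in at_right r. s < r + e"
        using e by (intro eventually_at_right_real[THEN eventually_mono, of r "r + e"]) auto
      ultimately show "\<forall>\<^sub>F s in at_right r. q s (A *v x) \<le> (r + e) * (p x + e)"
        using ev_r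
      proof eventually_elim
        case (elim s)
        have "q s (A *v x) \<le> s * q s x"
          using damped_norm_matrix_le[OF growth r elim(3) A, of x] d_pos[OF elim(3)]
          unfolding q_def N_def by (simp add: divide_right_mono)
        also have "\<dots> \<le> (r + e) * (p x + e)"
          using elim r q0[OF elim(3)] by (intro mult_mono) auto
        finally show ?case .
      qed
    qed
    have "((\<lambda>e. (r + e) * (p x + e)) \<longlongrightarrow> (r + 0) * (p x + 0)) (at_right 0)"
      by (intro tendsto_intros)
    moreover have "\<forall>\<^sub>F e in at_right 0. p (A *v x) \<le> (r + e) * (p x + e)"
      by (rule eventually_mono[OF eventually_at_right_less]) (rule *)
    ultimately show ?thesis
      using tendsto_lowerbound[of "\<lambda>e. (r + e) * (p x + e)"] by fastforce
  qed
  \<comment> \<open>Otherwise all \<open>q s b\<close> would eventually be too small to add up to \<open>1\<close>.\<close>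
  have "\<exists>x\<in>V. p x \<noteq> 0"
  proof (rule ccontr)
    assume "\<not> (\<exists>x\<in>V. p x \<noteq> 0)"
    then have pB: "p b = 0" if "b \<in> B" for b using that B(1) by blast
    define e where "e = 1 / (2 * real (card B))"
    have cB: "card B > 0" using finB Bne by (simp add: card_gt_0_iff)
    then have e: "e > 0" by (simp add: e_def)
    have "\<forall>\<^sub>F s in at_right r. \<forall>b\<in>B. q s b \<le> e"
      using finB B(1) pB e by (auto intro!: eventually_ball_finite p_gt)
    then have "\<forall>\<^sub>F s in at_right r. False"
      using ev_r
    proof eventually_elim
      case (elim s)
      have "(\<Sum>b\<in>B. q s b) \<le> (\<Sum>b\<in>B. e)"
        using elim by (intro sum_mono) auto
      then show ?case
        using qsum[OF elim(2)] cB by (simp add: e_def)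
    qed
    then show False by simp
  qed
  with sem p_mat that show ?thesis by blast
qed

section \<open>A basis with small coefficients\<close>

lemma representation_Un:
  fixes B1 B2 :: "('a::field ^ 'n) set"
  assumes ind: "vec.independent (B1 \<union> B2)" and disj: "B1 \<inter> B2 = {}"
    and x: "x1 \<in> vec.span B1" "x2 \<in> vec.span B2" and b: "b \<in> B1"
  shows "vec.representation (B1 \<union> B2) (x1 + x2) b = vec.representation B1 x1 b"
proof -
  have "x1 \<in> vec.span (B1 \<union> B2)" "x2 \<in> vec.span (B1 \<union> B2)"
    using x vec.span_mono[of B1 "B1 \<union> B2"] vec.span_mono[of B2 "B1 \<union> B2"] by auto
  then have "vec.representation (B1 \<union> B2) (x1 + x2) =
      (\<lambda>b. vec.representation (B1 \<union> B2) x1 b + vec.representation (B1 \<union> B2) x2 b)"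
    by (intro vec.representation_add ind)
  moreover have "vec.representation (B1 \<union> B2) x1 = vec.representation B1 x1"
    by (rule vec.representation_extend[OF ind x(1)]) simp
  moreover have "vec.representation (B1 \<union> B2) x2 = vec.representation B2 x2"
    by (rule vec.representation_extend[OF ind x(2)]) simp
  moreover have "vec.representation B2 x2 b = 0"
    using b disj vec.representation_ne_zero by blast
  ultimately show ?thesis by simp
qed

lemma span_Int_span_independent_Un:
  fixes B1 B2 :: "('a::field ^ 'n) set"
  assumes ind: "vec.independent (B1 \<union> B2)" and disj: "B1 \<inter> B2 = {}"
    and x: "x \<in> vec.span B1" "x \<in> vec.span B2"
  shows "x = 0"
proof -
  have ind1: "vec.independent B1" using ind vec.independent_mono by blast
  have fin: "finite B1" using ind1 vec.finiteI_independent by blast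
  have "vec.representation B1 x b = 0" if "b \<in> B1" for b
    using representation_Un[OF ind disj x(1) vec.span_zero that]
      representation_Un[OF ind disj vec.span_zero x(2) that] by (simp add: vec.representation_zero)
  then show ?thesis
    using vec.sum_representation_eq[OF ind1 x(1) fin subset_refl] by simp
qed

lemma seminorm_on_sum_representation:
  fixes B C :: "('a::real_normed_field ^ 'n) set"
  assumes "vec.independent B"
  shows "seminorm_on (vec.span B) (\<lambda>x. \<Sum>b\<in>C. norm (vec.representation B x b))"
  unfolding seminorm_on_def using assms
  by (auto simp: vec.representation_add vec.representation_scale norm_mult sum_distrib_left
      simp flip: sum.distrib intro!: sum_mono norm_triangle_ineq)

lemma growth_rate_imp_bounded:
  fixes M :: "('a::{real_normed_field,euclidean_space} ^ 'n ^ 'n) set"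
  assumes "growth_rate_le M r"
  obtains K where "0 \<le> K" "\<And>A x. A \<in> M \<Longrightarrow> norm (A *v x) \<le> K * norm x"
proof -
  obtain C where C: "\<And>t S x. S \<in> products_of_length M t \<Longrightarrow> norm (S *v x) \<le> C * (r + 1) ^ t * norm x"
    using assms unfolding growth_rate_le_def by (meson less_add_one)
  have "norm (A *v x) \<le> \<bar>C * (r + 1)\<bar> * norm x" if "A \<in> M" for A x
  proof -
    have "norm (A *v x) \<le> C * (r + 1) * norm x"
      using C[of A "Suc 0" x] that by (simp add: products_of_length_1)
    also have "\<dots> \<le> \<bar>C * (r + 1)\<bar> * norm x"
      by (intro mult_right_mono) auto
    finally show ?thesis .
  qed
  with that show ?thesis by (meson abs_ge_zero)
qed

text \<open>Induction on the dimension: the kernel \<open>W\<close> of an invariant seminorm \<open>p\<close> receives a basis \<open>BW\<close> from the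
  induction hypothesis, and a complement \<open>U\<close>, on which \<open>p\<close> is a norm, an Auerbach basis \<open>E\<close>. Taking
  \<open>E\<close> for the norm \<open>p / \<delta>\<close> shrinks its vectors by \<open>\<delta>\<close>; the bound for the
  coefficients within \<open>E\<close> grows by the factor \<open>1 / \<delta>\<close>, and the two effects cancel.\<close>

lemma basis_with_bounded_coefficients:
  fixes M :: "('a::{real_normed_field,euclidean_space} ^ 'n ^ 'n) set"
  assumes growth: "growth_rate_le M r" and r: "0 < r"
    and V: "vec.subspace V" and inv: "\<And>A x. A \<in> M \<Longrightarrow> x \<in> V \<Longrightarrow> A *v x \<in> V"
  shows "\<exists>B. vec.independent B \<and> vec.span B = V \<and>
    (\<forall>A\<in>M. \<forall>b\<in>B. \<forall>b'\<in>B. norm (vec.representation B (A *v b) b') \<le> r)"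
  using V inv
proof (induction "vec.dim V" arbitrary: V rule: less_induct)
  case less
  note V = less.prems(1) and inv = less.prems(2)
  show ?case
  proof (cases "V = {0}")
    case True
    then show ?thesis
      by (intro exI[of _ "{}"]) (auto simp: vec.independent_empty)
  next
    case False
    have r0: "0 \<le> r" using r by simp
    obtain p where p: "seminorm_on V p" and p_mat: "\<And>A x. A \<in> M \<Longrightarrow> x \<in> V \<Longrightarrow> p (A *v x) \<le> r * p x"
      and p_ne: "\<exists>x\<in>V. p x \<noteq> 0"
      using invariant_seminorm[OF growth r0 V False inv] by metis
    have p0: "0 \<le> p x" if "x \<in> V" for x
      using seminorm_on_nonneg[OF p V that] .
    define W where "W = {x \<in> V. p x = 0}"
    have W: "vec.subspace W"
    proof (rule vec.subspaceI)
      show "0 \<in> W" unfolding W_def using vec.subspace_0[OF V] seminorm_on_zero[OF p V] by simp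
      show "x + y \<in> W" if "x \<in> W" "y \<in> W" for x y
        using that vec.subspace_add[OF V] seminorm_on_add[OF p, of x y] p0[of "x + y"]
        unfolding W_def by auto
      show "c *s x \<in> W" if "x \<in> W" for c x
        using that vec.subspace_scale[OF V] seminorm_on_smult[OF p] unfolding W_def by auto
    qed
    have invW: "A *v x \<in> W" if "A \<in> M" "x \<in> W" for A x
      using that p_mat[of A x] inv[of A x] p0[of "A *v x"] unfolding W_def by auto
    have WV: "W \<subseteq> V" "W \<noteq> V"
      using p_ne unfolding W_def by auto
    have "vec.dim W < vec.dim V"
      using vec.subspace_dim_equal[OF W V WV(1)] WV(2) by force
    from less.hyps[OF this W invW] obtain BW where
      BW: "vec.independent BW" "vec.span BW = W" and
      BWr: "\<And>A b b'. A \<in> M \<Longrightarrow> b \<in> BW \<Longrightarrow> b' \<in> BW \<Longrightarrow> norm (vec.representation BW (A *v b) b') \<le> r"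
      by blast
    have BWW: "BW \<subseteq> W" using BW(2) vec.span_superset by blast
    obtain BV where BV: "BW \<subseteq> BV" "BV \<subseteq> V" "vec.independent BV" "V \<subseteq> vec.span BV"
      using vec.maximal_independent_subset_extend[of BW V] BW(1) BWW WV(1) by blast
    have finBV: "finite BV" using BV(3) vec.finiteI_independent by blast
    have spanBV: "vec.span BV = V" using BV(4) vec.span_minimal[OF BV(2) V] by blast
    define R where "R = BV - BW"
    define U where "U = vec.span R"
    have BV_eq: "BV = BW \<union> R" and disjR: "BW \<inter> R = {}" using BV(1) R_def by auto
    have indR: "vec.independent R" using BV(3) R_def vec.independent_mono by blast
    have U: "vec.subspace U" unfolding U_def by (rule vec.subspace_span)
    have UV: "U \<subseteq> V"
      unfolding U_def R_def by (rule vec.span_minimal[OF _ V]) (use BV(2) in auto)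
    have UW: "x = 0" if "x \<in> U" "x \<in> W" for x
      using span_Int_span_independent_Un[of BW R x] BV(3) BV_eq disjR that BW(2) U_def by simp
    have p_pos: "x = 0" if "x \<in> U" "p x = 0" for x
      using UW[OF that(1)] that UV unfolding W_def by auto
    have pU: "seminorm_on U p" by (rule seminorm_on_subset[OF p UV])

    obtain c where c: "c > 0" "\<And>x. x \<in> U \<Longrightarrow> c * norm x \<le> p x"
      using norm_on_ge_norm[OF U pU p_pos] by blast
    \<comment> \<open>The coefficients of \<open>x\<close> along \<open>BW\<close> depend on the complement \<open>U\<close> but not on the basis chosen in it,
      so that they can be bounded before \<open>\<delta>\<close> and \<open>E\<close> are known.\<close>
    obtain D where D: "0 \<le> D"
      "\<And>x. x \<in> V \<Longrightarrow> (\<Sum>b\<in>BW. norm (vec.representation BV x b)) \<le> D * norm x"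
      using seminorm_on_le_norm[OF V seminorm_on_sum_representation[OF BV(3), of BW, unfolded spanBV]] by blast
    obtain K where K: "0 \<le> K" "\<And>A x. A \<in> M \<Longrightarrow> norm (A *v x) \<le> K * norm x"
      using growth_rate_imp_bounded[OF growth] by blast
    \<comment> \<open>A vector of \<open>E\<close> will have norm at most \<open>\<delta> / c\<close>, so the coefficients of its image along \<open>BW\<close> are
      at most \<open>D * K * \<delta> / c\<close>, which this choice keeps below \<open>r\<close>.\<close>
    define \<delta> where "\<delta> = r * c / (D * K + 1)"
    have DK: "D * K + 1 > 0" using D K by (simp add: add_nonneg_pos)
    have \<delta>: "\<delta> > 0" unfolding \<delta>_def using r c(1) DK by simp

    have semp': "seminorm_on U (\<lambda>x. p x / \<delta>)"
      using pU \<delta> unfolding seminorm_on_def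
      by (auto simp: add_divide_distrib[symmetric] divide_right_mono)
    obtain E where E: "vec.independent E" "vec.span E = U" "\<And>e. e \<in> E \<Longrightarrow> p e / \<delta> \<le> 1"
      "\<And>x e. x \<in> U \<Longrightarrow> e \<in> E \<Longrightarrow> norm (vec.representation E x e) \<le> p x / \<delta>"
      using auerbach_basis[OF U semp'] p_pos \<delta> by auto
    have EU: "E \<subseteq> U" using E(2) vec.span_superset by blast
    have pE: "p e \<le> \<delta>" if "e \<in> E" for e using E(3)[OF that] \<delta> by simp
    have finE: "finite E" and finBW: "finite BW"
      using E(1) BW(1) vec.finiteI_independent by blast+
    have disjE: "BW \<inter> E = {}"
    proof -
      have "e \<noteq> 0" if "e \<in> E" for e using E(1) that vec.dependent_zero by blast
      then show ?thesis using UW EU BWW by blast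
    qed
    have decomp: "\<exists>w\<in>W. \<exists>u\<in>U. x = w + u" if "x \<in> V" for x
      using that unfolding spanBV[symmetric] BV_eq vec.span_Un BW(2) U_def by blast
    have spanG: "vec.span (BW \<union> E) = V"
      unfolding vec.span_Un BW(2) E(2) unfolding spanBV[symmetric] BV_eq vec.span_Un BW(2) U_def ..
    have indG: "vec.independent (BW \<union> E)"
    proof (rule vec.card_le_dim_spanning)
      show "BW \<union> E \<subseteq> V" using BWW WV(1) EU UV by blast
      show "V \<subseteq> vec.span (BW \<union> E)" using spanG by simp
      show "finite (BW \<union> E)" using finE finBW by simp
      have "card E = card R"
        using vec.dim_eq_card_independent[OF E(1)] vec.dim_eq_card_independent[OF indR]
          vec.dim_span[of E] vec.dim_span[of R] E(2) U_def by simp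
      moreover have "card BV = card BW + card R"
        unfolding BV_eq using finBV disjR finBW BV_eq by (intro card_Un_disjoint) auto
      moreover have "card (BW \<union> E) \<le> card BW + card E" by (rule card_Un_le)
      moreover have "vec.dim V = card BV"
        using vec.dim_eq_card_independent[OF BV(3)] vec.dim_span[of BV] spanBV by simp
      ultimately show "card (BW \<union> E) \<le> vec.dim V" by simp
    qed
    have repW: "vec.representation (BW \<union> E) (w + u) b = vec.representation BW w b"
      if "w \<in> W" "u \<in> U" "b \<in> BW" for w u b
      using representation_Un[OF indG disjE, of w u b] that BW(2) E(2) by simp
    have repE: "vec.representation (BW \<union> E) (w + u) b = vec.representation E u b"
      if "w \<in> W" "u \<in> U" "b \<in> E" for w u b
      using representation_Un[of E BW u w b] indG disjE that BW(2) E(2)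
      by (simp add: Un_commute Int_commute add.commute)
    have repV: "vec.representation BV (w + u) b = vec.representation BW w b"
      if "w \<in> W" "u \<in> U" "b \<in> BW" for w u b
      using representation_Un[of BW R w u b] BV(3) disjR that BW(2) unfolding BV_eq U_def by simp
    have "norm (vec.representation (BW \<union> E) (A *v b) b') \<le> r"
      if A: "A \<in> M" and b: "b \<in> BW \<union> E" and b': "b' \<in> BW \<union> E" for A b b'
    proof (cases "b \<in> BW")
      case True
      then have Ab: "A *v b \<in> W" using A invW BWW by blast
      show ?thesis
      proof (cases "b' \<in> BW")
        case b'W: True
        then show ?thesis
          using repW[OF Ab vec.subspace_0[OF U]] BWr[OF A True] by simp
      next
        case False
        then show ?thesis
          using repE[OF Ab vec.subspace_0[OF U], of b'] b' r0 by (simp add: vec.representation_zero)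
      qed
    next
      case False
      then have bE: "b \<in> E" using b by blast
      then have bV: "b \<in> U" "b \<in> V" using EU UV by auto
      then have AbV: "A *v b \<in> V" using inv A by blast
      obtain w u where wu: "w \<in> W" "u \<in> U" "A *v b = w + u" using decomp[OF AbV] by blast
      show ?thesis
      proof (cases "b' \<in> BW")
        case True
        have "norm (vec.representation (BW \<union> E) (A *v b) b') = norm (vec.representation BV (A *v b) b')"
          using repW[OF wu(1,2) True] repV[OF wu(1,2) True] wu(3) by simp
        also have "\<dots> \<le> (\<Sum>v\<in>BW. norm (vec.representation BV (A *v b) v))"
          using True finBW by (intro member_le_sum) auto
        also have "\<dots> \<le> D * (K * (\<delta> / c))"
        proof -
          have "norm b \<le> \<delta> / c"
            using c(2)[OF bV(1)] pE[OF bE] c(1) by (simp add: field_simps)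
          then have "norm (A *v b) \<le> K * (\<delta> / c)"
            using K(2)[OF A, of b] mult_left_mono[OF _ K(1)] order_trans by blast
          then show ?thesis
            using D(2)[OF AbV] mult_left_mono[OF _ D(1)] order_trans by blast
        qed
        also have "\<dots> = r * (D * K / (D * K + 1))"
          unfolding \<delta>_def using c(1) by simp
        also have "\<dots> \<le> r * 1"
          using r0 DK by (intro mult_left_mono) (auto simp: divide_le_eq_1)
        finally show ?thesis by simp
      next
        case False
        then have b'E: "b' \<in> E" using b' by blast
        \<comment> \<open>The coefficient along \<open>b'\<close> depends only on the part \<open>u\<close>, which differs from \<open>A *v b\<close> by an
          element of the kernel of \<open>p\<close>.\<close>
        have "- w \<in> W" using wu(1) vec.subspace_neg[OF W] by blast
        then have "p u \<le> p (A *v b)"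
          using seminorm_on_add[OF p AbV, of "- w"] wu WV(1) unfolding W_def by auto
        also have "\<dots> \<le> r * p b" by (rule p_mat[OF A bV(2)])
        also have "\<dots> \<le> r * \<delta>" using pE[OF bE] r0 by (intro mult_left_mono)
        finally have "p u / \<delta> \<le> r" using \<delta> by (simp add: field_simps)
        then show ?thesis
          using E(4)[OF wu(2) b'E] repE[OF wu(1,2) b'E] wu(3) by simp
      qed
    qed
    with indG spanG show ?thesis by blast
  qed
qed

section \<open>Similar matrices\<close>

lemma matrix_inv_right: "invertible A \<Longrightarrow> A ** matrix_inv A = mat 1"
  unfolding invertible_def matrix_inv_def by (drule someI_ex) simp

text \<open>In \<open>T\<^sup>-\<^sup>1 A T\<close>, where the columns of \<open>T\<close> form a basis, column \<open>j\<close> consists of the coefficients of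
  \<open>A\<close> applied to the \<open>j\<close>-th basis vector.\<close>

lemma similar_entries_le:
  fixes M :: "('a::{real_normed_field,euclidean_space} ^ 'n ^ 'n) set"
  assumes growth: "growth_rate_le M r" and r: "0 < r"
  obtains T where "invertible T" "\<And>x. x \<in> entry_moduli (similar_set T M) \<Longrightarrow> x \<le> r"
proof -
  obtain B where B: "vec.independent B" "vec.span B = UNIV"
    and Br: "\<And>A b b'. A \<in> M \<Longrightarrow> b \<in> B \<Longrightarrow> b' \<in> B \<Longrightarrow> norm (vec.representation B (A *v b) b') \<le> r"
    using basis_with_bounded_coefficients[OF growth r vec.subspace_UNIV] by auto
  obtain f :: "'n \<Rightarrow> 'a ^ 'n" where f: "bij_betw f UNIV B"
    and ind: "\<And>c. (\<Sum>i\<in>UNIV. c i *s f i) = 0 \<Longrightarrow> \<forall>i. c i = 0"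
    using indexed_basis[OF B] by blast
  have fB: "f i \<in> B" for i using f bij_betwE by blast
  define T where "T = (\<chi> i j. f j $ i)"
  have col: "column j T = f j" for j
    by (simp add: T_def column_def vec_lambda_eta)
  have "\<exists>L. L ** T = mat 1"
    unfolding matrix_left_invertible_independent_columns col using ind by blast
  then have T: "invertible T"
    by (simp add: invertible_left_inverse)
  have entry: "(matrix_inv T ** A ** T) $ i $ j = vec.representation B (A *v f j) (f i)" for A i j
  proof -
    define P where "P = matrix_inv T ** A ** T"
    have "T ** P = A ** T"
      by (simp add: P_def matrix_mul_assoc matrix_inv_right[OF T])
    moreover have "column j (A ** T) = A *v f j"
      by (simp add: col[symmetric] vec_eq_iff column_def matrix_matrix_mult_def matrix_vector_mult_def)
    moreover have "column j (T ** P) = (\<Sum>k\<in>UNIV. (P $ k $ j) *s f k)"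
      by (simp add: col[symmetric] vec_eq_iff column_def matrix_matrix_mult_def mult.commute)
    ultimately have "A *v f j = (\<Sum>k\<in>UNIV. (P $ k $ j) *s f k)" by simp
    then have "vec.representation B (A *v f j) (f i)
        = (\<Sum>k\<in>UNIV. P $ k $ j * vec.representation B (f k) (f i))"
      using B by (simp add: vec.representation_sum vec.representation_scale)
    also have "\<dots> = (\<Sum>k\<in>UNIV. if k = i then P $ k $ j else 0)"
      using f fB by (intro sum.cong refl)
        (auto simp: vec.representation_basis[OF B(1)] bij_betw_def inj_eq)
    finally show ?thesis by (simp add: P_def)
  qed
  have "x \<le> r" if "x \<in> entry_moduli (similar_set T M)" for x
    using that Br fB unfolding entry_moduli_def similar_set_def by (auto simp: entry)
  with T that show ?thesis by blast
qed

lemma entry_moduli_has_maximum: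
  fixes M :: "('a::{real_normed_field,euclidean_space} ^ 'n ^ 'n) set"
  assumes "M \<noteq> {}" "compact M"
  shows "\<exists>m. is_maximum m (entry_moduli (similar_set T M))"
proof -
  define g where "g A ij = norm ((matrix_inv T ** A ** T) $ fst ij $ snd ij)" for A and ij :: "'n \<times> 'n"
  have eq: "entry_moduli (similar_set T M) = (\<Union>ij. (\<lambda>A. g A ij) ` M)"
    unfolding entry_moduli_def similar_set_def g_def by (fastforce simp: image_iff)
  have "compact (\<Union>ij. (\<lambda>A. g A ij) ` M)"
  proof (intro compact_UN compact_continuous_image assms)
    fix ij
    show "continuous_on M (\<lambda>A. g A ij)"
      unfolding g_def matrix_matrix_mult_def by (simp, intro continuous_intros)
  qed simp
  moreover have "(\<Union>ij. (\<lambda>A. g A ij) ` M) \<noteq> {}" using assms(1) by auto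
  ultimately show ?thesis
    using compact_attains_sup[of "\<Union>ij. (\<lambda>A. g A ij) ` M"] unfolding is_maximum_def eq by metis
qed

theorem similarity_with_entries_le_joint_spectral_radius:
  fixes M :: "('a::{real_normed_field,euclidean_space} ^ 'n ^ 'n) set"
  assumes "M \<noteq> {}" "compact M" "joint_spectral_radius M > 0"
  shows "\<exists>T. invertible T \<and>
    (\<exists>m. is_maximum m (entry_moduli (similar_set T M)) \<and> joint_spectral_radius M \<ge> m)"
proof -
  have "growth_rate_le M (joint_spectral_radius M)"
    using assms(1,2) compact_imp_bounded growth_rate_joint_spectral_radius by blast
  then obtain T where T: "invertible T"
    "\<And>x. x \<in> entry_moduli (similar_set T M) \<Longrightarrow> x \<le> joint_spectral_radius M"
    using similar_entries_le[OF _ assms(3)] by blast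
  obtain m where "is_maximum m (entry_moduli (similar_set T M))"
    using entry_moduli_has_maximum[OF assms(1,2)] by blast
  with T show ?thesis
    unfolding is_maximum_def by blast
qed

theorem proposition3p3:
  "(\<forall>M :: (real ^ 'n ^ 'n) set.
      M \<noteq> {} \<longrightarrow> compact M \<longrightarrow> joint_spectral_radius M > 0 \<longrightarrow>
      (\<exists>T :: real ^ 'n ^ 'n. invertible T \<and>
         (\<exists>m. is_maximum m (entry_moduli (similar_set T M)) \<and> joint_spectral_radius M \<ge> m))) \<and>
   (\<forall>M :: (complex ^ 'n ^ 'n) set.
      M \<noteq> {} \<longrightarrow> compact M \<longrightarrow> joint_spectral_radius M > 0 \<longrightarrow>
      (\<exists>T :: complex ^ 'n ^ 'n. invertible T \<and>
         (\<exists>m. is_maximum m (entry_moduli (similar_set T M)) \<and> joint_spectral_radius M \<ge> m)))"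
  by (intro conjI allI impI similarity_with_entries_le_joint_spectral_radius)

end
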